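(* Let $V$ be a finite set, $f\colon 2^V\to\mathbb{R}_{\ge 0}$ a monotone submodular function with $f(\emptyset)=0$, and $\mathcal{M}$ a matroid on $V$ of rank $k\ge 1$. The partition $\mathcal{P}_k$ returned by the greedy splitting algorithm on $(f,\mathcal{M})$ (described in the context) is feasible and satisfies $f(\mathcal{P}_k)\le (2-2/k)\,\mathrm{OPT}$, where $\mathrm{OPT}$ is the optimum value of the Submodular Matroid-constrained Partitioning problem for $(f,\mathcal{M})$.
   Context: $f$ is submodular if $f(A)+f(B)\ge f(A\cup B)+f(A\cap B)$ for all $A,B\subseteq V$, monotone if $f(A)\le f(B)$ whenever $A\subseteq B$. For a partition $\mathcal{P}$ of $V$, $f(\mathcal{P})=\sum_{X\in\mathcal{P}}f(X)$. Submodular Matroid-constrained Partitioning: given $f$ and a rank-$k$ matroid $\mathcal{M}=(V,\mathcal{I})$ with bases $\mathcal{B}$, a partition $\{V_1,\dots,V_k\}$ of $V$ is feasible if some $B\in\mathcal{B}$ has $|B\cap V_i|=1$ for all $i$; minimize $f(\mathcal{P})$ over feasible $\mathcal{P}$; $\mathrm{OPT}$ denotes the minimum. A transversal of a partition is a set containing exactly one element of each class. Greedy splitting algorithm: set $\mathcal{P}_1=\{V\}$. For $i=1,\dots,k-1$: among all pairs $(X,W)$ with $W\in\mathcal{P}_i$, $X\subseteq W$, such that some $I\in\mathcal{I}$ is a transversal of $(\mathcal{P}_i\setminus\{W\})\cup\{X,W\setminus X\}$, choose one minimizing $f(X)+f(W\setminus X)-f(W)$, and set $\mathcal{P}_{i+1}=(\mathcal{P}_i\setminus\{W\})\cup\{X,W\setminus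 X\}$. Return $\mathcal{P}_k$.
   Formalization: The bound f(P_k) ≤ (2-2/k) OPT is proved for k ≥ 2 only, since at k = 1 it would read f(V) ≤ 0, which fails for V = {a}, f({a}) = 1 and the free matroid; feasibility is proved for all k ≥ 1. *)

theory Defs
  imports Complex_Main "HOL-Library.Disjoint_Sets"
begin

definition submodular_on :: "'a set \<Rightarrow> ('a set \<Rightarrow> real) \<Rightarrow> bool" where
  "submodular_on V f \<longleftrightarrow>
    (\<forall>A B. A \<subseteq> V \<longrightarrow> B \<subseteq> V \<longrightarrow> f A + f B \<ge> f (A \<union> B) + f (A \<inter> B))"

locale matroid =
  fixes V :: "'a set" and \<I> :: "'a set set"
  assumes finite_ground: "finite V"
    and indep_subset_ground: "A \<in> \<I> \<Longrightarrow> A \<subseteq> V"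
    and empty_indep: "{} \<in> \<I>"
    and indep_subset: "A \<in> \<I> \<Longrightarrow> B \<subseteq> A \<Longrightarrow> B \<in> \<I>"
    and indep_augment:
      "A \<in> \<I> \<Longrightarrow> B \<in> \<I> \<Longrightarrow> card A < card B \<Longrightarrow> \<exists>x \<in> B - A. insert x A \<in> \<I>"

definition matroid_bases :: "'a set set \<Rightarrow> 'a set set" where
  "matroid_bases \<I> = {B \<in> \<I>. \<forall>A \<in> \<I>. B \<subseteq> A \<longrightarrow> A = B}"

definition matroid_rank :: "'a set set \<Rightarrow> nat" where
  "matroid_rank \<I> = Max (card ` \<I>)"

definition feasible_partition :: "'a set \<Rightarrow> 'a set set \<Rightarrow> 'a set set \<Rightarrow> bool" where
  "feasible_partition V \<I> P \<longleftrightarrow>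
    partition_on V P \<and> card P = matroid_rank \<I> \<and>
    (\<exists>B \<in> matroid_bases \<I>. \<forall>X \<in> P. card (B \<inter> X) = 1)"

definition opt_value :: "('a set \<Rightarrow> real) \<Rightarrow> 'a set \<Rightarrow> 'a set set \<Rightarrow> real" where
  "opt_value f V \<I> = Min (sum f ` {P. feasible_partition V \<I> P})"

definition is_transversal :: "'a set \<Rightarrow> 'a set set \<Rightarrow> bool" where
  "is_transversal T P \<longleftrightarrow> (\<forall>X \<in> P. \<exists>!x. x \<in> T \<inter> X)"

definition split_class :: "'a set set \<Rightarrow> 'a set \<Rightarrow> 'a set \<Rightarrow> 'a set set" where
  "split_class P X W = (P - {W}) \<union> {X, W - X}"

text \<open>A family with an empty member has no transversal, so the choices \<open>X = {}\<close> and
  \<open>X = W\<close> are never admissible.\<close>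

definition admissible_split :: "'a set set \<Rightarrow> 'a set set \<Rightarrow> 'a set \<Rightarrow> 'a set \<Rightarrow> bool" where
  "admissible_split \<I> P X W \<longleftrightarrow>
    W \<in> P \<and> X \<subseteq> W \<and> (\<exists>T \<in> \<I>. is_transversal T (split_class P X W))"

definition split_cost :: "('a set \<Rightarrow> real) \<Rightarrow> 'a set \<Rightarrow> 'a set \<Rightarrow> real" where
  "split_cost f X W = f X + f (W - X) - f W"

text \<open>The algorithm does not specify how ties are broken, so it is modelled as a relation:
  \<open>greedy_splitting f V \<I> i P\<close> holds iff \<open>P\<close> can occur as the \<open>i\<close>-th partition
  (counting from 1) in some run.\<close>

inductive greedy_splitting ::
    "('a set \<Rightarrow> real) \<Rightarrow> 'a set \<Rightarrow> 'a set set \<Rightarrow> nat \<Rightarrow> 'a set set \<Rightarrow> bool"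
  for f :: "'a set \<Rightarrow> real" and V :: "'a set" and \<I> :: "'a set set" where
  init: "greedy_splitting f V \<I> 1 {V}"
| step: "greedy_splitting f V \<I> i P \<Longrightarrow>
    is_arg_min (\<lambda>(X, W). split_cost f X W) (\<lambda>(X, W). admissible_split \<I> P X W) (X, W) \<Longrightarrow>
    greedy_splitting f V \<I> (Suc i) (split_class P X W)"

end

theory Submission
  imports Defs
begin

text \<open>
  Let \<open>Q\<close> be an optimal partition with transversal base \<open>B\<close>, and write
  \<open>c A = f A + f (V - A) - f V\<close> for a class \<open>A\<close> of \<open>Q\<close>. By submodularity, cutting any class \<open>W\<close>
  of the current partition along \<open>A\<close> costs at most \<open>c A\<close>. If the current partition has \<open>i < k\<close>
  classes, choose an independent transversal \<open>T\<close> of it with \<open>card (T \<inter> B)\<close> maximal and extend \<open>T\<close>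
  by a set \<open>C \<subseteq> B\<close> of size \<open>k - i\<close>. For \<open>b \<in> C\<close> lying in the same class as \<open>t \<in> T\<close>,
  maximality forces \<open>t \<in> B\<close>, as otherwise \<open>t\<close> could be exchanged for \<open>b\<close>. Hence both the class
  of \<open>Q\<close> containing \<open>b\<close> and the one containing \<open>t\<close> give an admissible cut, so at least
  \<open>k - i + 1\<close> classes of \<open>Q\<close> do, and every set of \<open>i\<close> classes of \<open>Q\<close> contains one of these.
  Inductively, the partition of step \<open>i\<close> costs at most \<open>f V\<close> plus the sum of \<open>c\<close> over an
  arbitrary set of \<open>i - 1\<close> classes of \<open>Q\<close>. For \<open>i = k\<close>, omit the most expensive class of \<open>Q\<close>;
  bound \<open>f V + c Y\<close> by \<open>OPT\<close> for the second most expensive class \<open>Y\<close>, and \<open>c A\<close> by \<open>f A\<close>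
  for all others.
\<close>

lemma exists_max_on:
  fixes g :: "'b \<Rightarrow> 'c :: linorder"
  assumes "finite R" "R \<noteq> {}"
  obtains Z where "Z \<in> R" "\<And>A. A \<in> R \<Longrightarrow> g A \<le> g Z"
proof -
  have "Max (g ` R) \<in> g ` R" using assms by simp
  then show thesis using that assms(1) by (metis (no_types, lifting) Max_ge finite_imageI imageE imageI)
qed

section \<open>Transversals and splitting of partitions\<close>

lemma is_transversal_iff_card:
  fixes T :: "'a set"
  shows "is_transversal T P \<longleftrightarrow> (\<forall>X\<in>P. card (T \<inter> X) = 1)"
proof -
  have "(\<exists>!x. x \<in> S) \<longleftrightarrow> card S = 1" for S :: "'a set"
  proof
    assume "\<exists>!x. x \<in> S"
    then obtain x where "S = {x}" by blast
    then show "card S = 1" by simp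
  next
    assume "card S = 1"
    then obtain x where "S = {x}" by (rule card_1_singletonE)
    then show "\<exists>!x. x \<in> S" by blast
  qed
  then show ?thesis unfolding is_transversal_def by (simp only:)
qed

lemma is_transversalD:
  assumes "is_transversal T P" "X \<in> P" "x \<in> T" "x \<in> X" "y \<in> T" "y \<in> X"
  shows "x = y"
  using assms unfolding is_transversal_def by blast

lemma card_transversal:
  assumes "finite V" "partition_on V P" "is_transversal T P" "T \<subseteq> V"
  shows "card T = card P"
proof -
  have "finite P" using assms finite_elements by blast
  have "T = (\<Union>X\<in>P. T \<inter> X)" using assms(2,4) by (auto simp: partition_on_def)
  then have "card T = card (\<Union>X\<in>P. T \<inter> X)" by simp
  also have "\<dots> = (\<Sum>X\<in>P. card (T \<inter> X))"
  proof (rule card_UN_disjoint[OF \<open>finite P\<close>])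
    show "\<forall>X\<in>P. finite (T \<inter> X)" using assms finite_subset by blast
    show "\<forall>X\<in>P. \<forall>Y\<in>P. X \<noteq> Y \<longrightarrow> T \<inter> X \<inter> (T \<inter> Y) = {}"
      using partition_onD2[OF assms(2)] by (auto simp: disjoint_def)
  qed
  also have "\<dots> = card P" using assms(3) by (simp add: is_transversal_iff_card)
  finally show ?thesis .
qed

text \<open>The only element of \<open>T\<close> in \<open>W\<close> is \<open>t\<close>, and
  \<open>A\<close> separates it from \<open>b\<close>, so each half of \<open>W\<close> receives
  exactly one of the two.\<close>

lemma transversal_split:
  assumes "partition_on V P" "is_transversal T P" "W \<in> P"
    and "t \<in> T" "t \<in> W" "b \<in> W" and sep: "t \<in> A \<longleftrightarrow> b \<notin> A"
  shows "is_transversal (insert b T) (split_class P (W \<inter> A) W)"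
proof -
  have other: "b \<notin> X" if "X \<in> P - {W}" for X
    using that assms partition_onD2[OF assms(1)] by (auto simp: disjoint_def)
  have uniq: "x = t" if "x \<in> T" "x \<in> W" for x
    using is_transversalD[OF assms(2,3)] that assms by blast
  have "\<exists>!x. x \<in> insert b T \<inter> X" if "X \<in> P - {W}" for X
    using other[OF that] that assms(2) unfolding is_transversal_def by auto
  moreover have "\<exists>!x. x \<in> insert b T \<inter> (W \<inter> A)" "\<exists>!x. x \<in> insert b T \<inter> (W - W \<inter> A)"
    using uniq sep assms(4-6) by blast+
  ultimately show ?thesis
    unfolding is_transversal_def split_class_def Ball_def Un_iff insert_iff empty_iff
    by (metis (no_types, lifting))
qed

lemma transversal_exchange:
  assumes "partition_on V P" "is_transversal T P" "W \<in> P"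
    and "t \<in> T" "t \<in> W" "b \<in> W"
  shows "is_transversal (insert b (T - {t})) P"
proof -
  have other: "b \<notin> X" "t \<notin> X" if "X \<in> P" "X \<noteq> W" for X
    using that assms partition_onD2[OF assms(1)] by (auto simp: disjoint_def)
  have uniq: "x = t" if "x \<in> T" "x \<in> W" for x
    using is_transversalD[OF assms(2,3)] that assms by blast
  have "\<exists>!x. x \<in> insert b (T - {t}) \<inter> X" if "X \<in> P" for X
  proof (cases "X = W")
    case True
    then show ?thesis using uniq assms(6) by blast
  next
    case False
    then have "insert b (T - {t}) \<inter> X = T \<inter> X" using other[OF that] by auto
    then show ?thesis using assms(2) that unfolding is_transversal_def by simp
  qed
  then show ?thesis unfolding is_transversal_def by blast
qed

text \<open>Nonempty halves are distinct from each other and from all other classes, so nothing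
  collapses in the set \<open>split_class P X W\<close>.\<close>

lemma split_class_partition:
  assumes "finite V" "partition_on V P" "W \<in> P" "X \<subseteq> W" "X \<noteq> {}" "W - X \<noteq> {}"
  shows "partition_on V (split_class P X W)"
    and "card (split_class P X W) = Suc (card P)"
    and "sum f (split_class P X W) = sum f P + split_cost f X W"
proof -
  have fin: "finite P" using assms finite_elements by blast
  have disj: "Y \<inter> W = {}" if "Y \<in> P - {W}" for Y
    using that assms(3) partition_onD2[OF assms(2)] by (auto simp: disjoint_def)
  have disj2: "Y \<inter> Z = {}" if "Y \<in> P" "Z \<in> P" "Y \<noteq> Z" for Y Z
    using that partition_onD2[OF assms(2)] by (auto simp: disjoint_def)
  have new: "X \<notin> P - {W}" "W - X \<notin> P - {W}" "X \<noteq> W - X"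
    using disj assms(4-6) by blast+
  show "partition_on V (split_class P X W)"
  proof (rule partition_onI)
    show "\<Union>(split_class P X W) = V"
      using assms(3,4) partition_onD1[OF assms(2)] unfolding split_class_def by blast
    show "disjnt Y Z" if "Y \<in> split_class P X W" "Z \<in> split_class P X W" "Y \<noteq> Z" for Y Z
      using that disj disj2 assms(4) unfolding split_class_def disjnt_def by blast
    show "{} \<notin> split_class P X W"
      using assms(5,6) partition_onD3[OF assms(2)] unfolding split_class_def by blast
  qed
  have eq: "split_class P X W = insert X (insert (W - X) (P - {W}))"
    unfolding split_class_def by auto
  show "card (split_class P X W) = Suc (card P)"
    using new fin assms(3) card_Suc_Diff1[OF fin assms(3)] by (simp add: eq)
  have "sum f P = f W + sum f (P - {W})" using fin assms(3) by (rule sum.remove)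
  then show "sum f (split_class P X W) = sum f P + split_cost f X W"
    using new fin by (simp add: eq split_cost_def)
qed

text \<open>Submodularity is applied to \<open>A\<close>, \<open>W\<close> and then to
  \<open>V - A\<close>, \<open>A \<union> W\<close>; adding the two inequalities cancels
  \<open>f (A \<union> W)\<close>.\<close>

lemma submodular_cut_cost:
  assumes "submodular_on V f" "A \<subseteq> V" "W \<subseteq> V"
  shows "split_cost f (W \<inter> A) W \<le> f A + f (V - A) - f V"
proof -
  have sub: "f (X \<union> Y) + f (X \<inter> Y) \<le> f X + f Y" if "X \<subseteq> V" "Y \<subseteq> V" for X Y
    using assms(1) that unfolding submodular_on_def by blast
  have "f (A \<union> W) + f (A \<inter> W) \<le> f A + f W"
    using sub[OF assms(2,3)] .
  moreover have "f ((V - A) \<union> (A \<union> W)) + f ((V - A) \<inter> (A \<union> W)) \<le> f (V - A) + f (A \<union> W)"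
    by (rule sub) (use assms in auto)
  moreover have "(V - A) \<union> (A \<union> W) = V" "(V - A) \<inter> (A \<union> W) = W - W \<inter> A"
    using assms by auto
  ultimately show ?thesis by (simp add: split_cost_def Int_commute)
qed

text \<open>Nonnegativity lets the intersection term of submodularity be dropped.\<close>

lemma submodular_Union_le:
  assumes "submodular_on V f" "f {} = 0" "\<And>A. A \<subseteq> V \<Longrightarrow> 0 \<le> f A"
    and "finite R" "\<Union>R \<subseteq> V"
  shows "f (\<Union>R) \<le> sum f R"
  using assms(4,5)
proof (induction R)
  case empty
  then show ?case using assms(2) by simp
next
  case (insert X R)
  have "f (X \<union> \<Union>R) + f (X \<inter> \<Union>R) \<le> f X + f (\<Union>R)"
    using insert.prems assms(1) unfolding submodular_on_def by simp
  moreover have "0 \<le> f (X \<inter> \<Union>R)" by (rule assms(3)) (use insert.prems in auto)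
  ultimately show ?case using insert by simp
qed

section \<open>Independent sets and admissible splits\<close>

context matroid
begin

lemma finite_indep: "A \<in> \<I> \<Longrightarrow> finite A"
  using finite_ground indep_subset_ground finite_subset by blast

lemma finite_indep_sets: "finite \<I>"
  using finite_subset[of \<I> "Pow V"] finite_ground indep_subset_ground by auto

lemma card_indep_le_rank: "A \<in> \<I> \<Longrightarrow> card A \<le> matroid_rank \<I>"
  unfolding matroid_rank_def using finite_indep_sets by simp

lemma obtain_indep_card_rank:
  obtains B where "B \<in> \<I>" "card B = matroid_rank \<I>"
proof -
  have "Max (card ` \<I>) \<in> card ` \<I>" using finite_indep_sets empty_indep by (intro Max_in) auto
  then show thesis using that unfolding matroid_rank_def by auto
qed

lemma indep_extend:
  assumes "T \<in> \<I>" "B \<in> \<I>" "card T \<le> card B"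
  shows "\<exists>C \<subseteq> B - T. T \<union> C \<in> \<I> \<and> card C = card B - card T"
  using assms
proof (induction "card B - card T" arbitrary: T)
  case 0
  then show ?case by (intro exI[of _ "{}"]) auto
next
  case (Suc n)
  then obtain x where x: "x \<in> B - T" "insert x T \<in> \<I>"
    using indep_augment[of T B] by force
  have cT: "card (insert x T) = Suc (card T)" using x finite_indep[OF Suc.prems(1)] by simp
  have n: "n = card B - card (insert x T)" and le: "card (insert x T) \<le> card B"
    using cT Suc.hyps(2) by linarith+
  obtain C where C: "C \<subseteq> B - insert x T" "insert x T \<union> C \<in> \<I>"
      "card C = card B - card (insert x T)"
    using Suc.hyps(1)[OF n x(2) Suc.prems(2) le] by blast
  have "finite C" using C(1) finite_indep[OF Suc.prems(2)] by (meson Diff_subset finite_subset)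
  then have "card (insert x C) = Suc (card C)" using C(1) by (subst card_insert_disjoint) auto
  then show ?case
    using C x cT Suc.hyps(2) by (intro exI[of _ "insert x C"]) auto
qed

lemma admissible_cut:
  assumes "partition_on V P" "is_transversal T P" "insert b T \<in> \<I>" "W \<in> P"
    and "t \<in> T" "t \<in> W" "b \<in> W" "t \<in> A \<longleftrightarrow> b \<notin> A"
  shows "admissible_split \<I> P (W \<inter> A) W"
  using transversal_split[OF assms(1,2,4-8)] assms(3,4) unfolding admissible_split_def by blast

lemma obtain_class:
  assumes "partition_on V P" "is_transversal T P" "b \<in> V"
  obtains W t where "W \<in> P" "b \<in> W" "t \<in> T" "t \<in> W"
  using assms partition_onD1[OF assms(1)] unfolding is_transversal_def by blast

text \<open>Augmenting \<open>T\<close> by some \<open>b\<close> allows the singleton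
  \<open>{b}\<close> to be cut off its class; this keeps the algorithm from getting stuck.\<close>

lemma exists_admissible:
  assumes P: "partition_on V P" and T: "T \<in> \<I>" "is_transversal T P" and "card P < matroid_rank \<I>"
  shows "\<exists>X W. admissible_split \<I> P X W"
proof -
  obtain B where B: "B \<in> \<I>" "card B = matroid_rank \<I>" by (rule obtain_indep_card_rank)
  have "card T = card P"
    using card_transversal[OF finite_ground P T(2)] indep_subset_ground T(1) by blast
  then obtain b where b: "b \<in> B - T" "insert b T \<in> \<I>"
    using indep_augment[OF T(1) B(1)] B(2) assms(4) by auto
  have "b \<in> V" using b B indep_subset_ground by blast
  then obtain W t where "W \<in> P" "b \<in> W" "t \<in> T" "t \<in> W" using obtain_class[OF P T(2)] by blast
  then have "admissible_split \<I> P (W \<inter> {b}) W"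
    using b by (intro admissible_cut[OF P T(2) b(2), of W t]) auto
  then show ?thesis by blast
qed

text \<open>Allowing any \<open>S\<close> with as many classes as \<open>P\<close> lets the cost
  induction charge each greedy step to a class of a prescribed set.\<close>

lemma exists_admissible_cut:
  assumes P: "partition_on V P" and ex: "\<exists>T\<in>\<I>. is_transversal T P"
    and Q: "partition_on V Q" and B: "B \<in> \<I>" "is_transversal B Q"
    and lt: "card P < card Q" and S: "S \<subseteq> Q" "card S = card P"
  shows "\<exists>A\<in>S. \<exists>W. admissible_split \<I> P (W \<inter> A) W"
proof -
  let ?trans = "{T \<in> \<I>. is_transversal T P}"
  have "finite ?trans" "?trans \<noteq> {}" using finite_indep_sets ex by auto
  then obtain T where T: "T \<in> \<I>" "is_transversal T P"
    and maxT: "\<And>T'. T' \<in> \<I> \<Longrightarrow> is_transversal T' P \<Longrightarrow> card (T' \<inter> B) \<le> card (T \<inter> B)"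
    by (rule exists_max_on[where g = "\<lambda>T. card (T \<inter> B)"]) auto
  have cT: "card T = card P" and cB: "card B = card Q"
    using card_transversal[OF finite_ground] P Q T B indep_subset_ground by blast+
  obtain C where C: "C \<subseteq> B - T" "T \<union> C \<in> \<I>" "card C = card B - card T"
    using indep_extend[OF T(1) B(1)] cT cB lt by auto
  have finB: "finite B" using finite_indep B by blast
  have indC: "insert c T \<in> \<I>" if "c \<in> C" for c
    using indep_subset[OF C(2)] that by blast
  \<comment> \<open>Exchanging a \<open>t\<close> outside \<open>B\<close> for \<open>c\<close>
    would yield an independent transversal meeting \<open>B\<close> in one more element.\<close>
  have partner: "t \<in> B" if "c \<in> C" "W \<in> P" "c \<in> W" "t \<in> T" "t \<in> W" for c W t
  proof (rule ccontr)
    assume "t \<notin> B"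
    have "insert c (T - {t}) \<in> \<I>" by (rule indep_subset[OF indC[OF that(1)]]) auto
    moreover have "is_transversal (insert c (T - {t})) P"
      using transversal_exchange[OF P T(2)] that by blast
    ultimately have "card (insert c (T - {t}) \<inter> B) \<le> card (T \<inter> B)" by (rule maxT)
    moreover have "insert c (T - {t}) \<inter> B = insert c (T \<inter> B)" "c \<notin> T"
      using \<open>t \<notin> B\<close> that(1) C(1) by auto
    ultimately show False using finB by simp
  qed
  have CV: "C \<subseteq> V" using C(1) indep_subset_ground[OF B(1)] by blast
  have "card C > 0" using C(3) cT cB lt by simp
  then obtain c where c: "c \<in> C" by (metis card_gt_0_iff ex_in_conv)
  then obtain W t where W: "W \<in> P" "c \<in> W" "t \<in> T" "t \<in> W"
    using obtain_class[OF P T(2)] CV by blast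
  have t: "t \<in> B" "t \<notin> C" using partner[OF c W] W C(1) by auto
  have "finite C" using \<open>card C > 0\<close> card_ge_0_finite by blast
  \<comment> \<open>Since \<open>t \<notin> C\<close>, removing \<open>insert t C\<close> takes one
    element more than \<open>card Q - card P\<close>, leaving fewer than
    \<open>card P\<close>.\<close>
  have cD: "card (B - insert t C) < card S"
  proof -
    have "card (insert t C) = Suc (card C)" using t \<open>finite C\<close> by simp
    moreover have "insert t C \<subseteq> B" using t C(1) by auto
    ultimately have "card (B - insert t C) = card B - Suc (card C)"
      using card_Diff_subset[of "insert t C" B] \<open>finite C\<close> by simp
    moreover have "Suc (card C) \<le> card B"
      using card_mono[OF finB \<open>insert t C \<subseteq> B\<close>] \<open>card (insert t C) = Suc (card C)\<close> by simp
    ultimately show ?thesis using C(3) cT cB lt S(2) by linarith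
  qed
  have "\<forall>A\<in>S. \<exists>b. b \<in> B \<and> b \<in> A" using B(2) S(1) unfolding is_transversal_def by blast
  then obtain r where r: "\<And>A. A \<in> S \<Longrightarrow> r A \<in> B \<and> r A \<in> A" by metis
  have "inj_on r S"
    using r S(1) partition_onD2[OF Q] unfolding disjoint_def inj_on_def by (metis IntI empty_iff subsetD)
  \<comment> \<open>Pigeonhole: the representatives of the classes in \<open>S\<close> are too many
    to avoid \<open>insert t C\<close>.\<close>
  then have "\<not> r ` S \<subseteq> B - insert t C"
    using cD finB card_inj_on_le[of r S "B - insert t C"] by auto
  then obtain A where A: "A \<in> S" "r A \<in> insert t C" using r by auto
  have only: "x = r A" if "x \<in> B" "x \<in> A" for x
    using is_transversalD[OF B(2), of A] that r[OF A(1)] A(1) S(1) by blast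
  \<comment> \<open>In either case \<open>A\<close> separates an element of \<open>C\<close> from
    its classmate in \<open>T\<close>: both lie in \<open>B\<close>, which meets \<open>A\<close>
    only in \<open>r A\<close>.\<close>
  show ?thesis
  proof (cases "r A \<in> C")
    case True
    then obtain W' t' where W': "W' \<in> P" "r A \<in> W'" "t' \<in> T" "t' \<in> W'"
      using obtain_class[OF P T(2)] CV by blast
    have "t' \<in> B" using partner True W' by blast
    moreover have "t' \<noteq> r A" using True C(1) W' by auto
    ultimately have "t' \<notin> A" using only by blast
    then have "admissible_split \<I> P (W' \<inter> A) W'"
      using admissible_cut[OF P T(2) indC[OF True]] W' r A(1) by blast
    then show ?thesis using A(1) by blast
  next
    case False
    then have "r A = t" using A by simp
    moreover have "c \<in> B" "c \<noteq> t" using c t C(1) by auto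
    ultimately have "t \<in> A" "c \<notin> A" using only r[OF A(1)] by auto
    then have "admissible_split \<I> P (W \<inter> A) W"
      using admissible_cut[OF P T(2) indC[OF c]] W by blast
    then show ?thesis using A(1) by blast
  qed
qed

lemma admissible_split_partition:
  assumes "partition_on V P" "admissible_split \<I> P X W"
  shows "partition_on V (split_class P X W)"
    and "card (split_class P X W) = Suc (card P)"
    and "sum f (split_class P X W) = sum f P + split_cost f X W"
proof -
  \<comment> \<open>A transversal meets both halves, so neither is empty.\<close>
  have "W \<in> P" "X \<subseteq> W" "X \<noteq> {}" "W - X \<noteq> {}"
    using assms(2) unfolding admissible_split_def is_transversal_def split_class_def by blast+
  note * = split_class_partition[OF finite_ground assms(1) this]
  show "partition_on V (split_class P X W)"
    "card (split_class P X W) = Suc (card P)"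
    "sum f (split_class P X W) = sum f P + split_cost f X W"
    using * by blast+
qed

section \<open>Runs of the greedy algorithm\<close>

lemma greedy_splitting_invariant:
  assumes "greedy_splitting f V \<I> i P" "matroid_rank \<I> \<ge> 1"
  shows "partition_on V P \<and> card P = i \<and> (\<exists>T\<in>\<I>. is_transversal T P)"
  using assms(1)
proof induction
  case init
  obtain B where B: "B \<in> \<I>" "card B = matroid_rank \<I>" by (rule obtain_indep_card_rank)
  then obtain b where "b \<in> B" using assms(2) by fastforce
  then have "{b} \<in> \<I>" "b \<in> V" using indep_subset[OF B(1)] indep_subset_ground[OF B(1)] by auto
  moreover from \<open>b \<in> V\<close> have "is_transversal {b} {V}" unfolding is_transversal_def by auto
  moreover from \<open>b \<in> V\<close> have "partition_on V {V}" by (auto simp: partition_on_def)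
  ultimately show ?case by auto
next
  case (step i P X W)
  have adm: "admissible_split \<I> P X W" using step.hyps(2) by (simp add: is_arg_min_def)
  then have "\<exists>T\<in>\<I>. is_transversal T (split_class P X W)" by (simp add: admissible_split_def)
  then show ?case
    using admissible_split_partition[OF _ adm] step.IH by auto
qed

text \<open>Below the rank an admissible pair exists, and the pairs are finite in number, so a
  minimizer can be chosen.\<close>

lemma greedy_splitting_exists:
  assumes "1 \<le> i" "i \<le> matroid_rank \<I>"
  shows "\<exists>P. greedy_splitting f V \<I> i P"
  using assms
proof (induction i rule: dec_induct)
  case base
  show ?case using greedy_splitting.init by blast
next
  case (step n)
  then obtain P where P: "greedy_splitting f V \<I> n P" by auto
  then have inv: "partition_on V P" "card P = n" "\<exists>T\<in>\<I>. is_transversal T P"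
    using greedy_splitting_invariant step by auto
  then obtain X0 W0 where "admissible_split \<I> P X0 W0"
    using exists_admissible step.prems by (metis Suc_le_eq)
  let ?adm = "{(X, W). admissible_split \<I> P X W}"
  have "?adm \<subseteq> Pow V \<times> Pow V"
    using inv(1) by (auto simp: admissible_split_def partition_on_def)
  then have "finite ?adm" using finite_ground by (meson finite_Pow_iff finite_SigmaI finite_subset)
  moreover have "?adm \<noteq> {}" using \<open>admissible_split \<I> P X0 W0\<close> by auto
  ultimately obtain XW where "is_arg_min (\<lambda>(X, W). split_cost f X W) (\<lambda>p. p \<in> ?adm) XW"
    using ex_is_arg_min_if_finite by blast
  moreover obtain X W where "XW = (X, W)" by (cases XW)
  ultimately have "greedy_splitting f V \<I> (Suc n) (split_class P X W)"
    using greedy_splitting.step[OF P, of X W] by simp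
  then show ?case by blast
qed

text \<open>After rank many classes the independent transversal has full rank, hence is a
  base.\<close>

lemma greedy_splitting_feasible:
  assumes "greedy_splitting f V \<I> (matroid_rank \<I>) P" "matroid_rank \<I> \<ge> 1"
  shows "feasible_partition V \<I> P"
proof -
  obtain T where P: "partition_on V P" "card P = matroid_rank \<I>" and T: "T \<in> \<I>" "is_transversal T P"
    using greedy_splitting_invariant[OF assms] by auto
  have cT: "card T = matroid_rank \<I>"
    using card_transversal[OF finite_ground P(1) T(2)] indep_subset_ground T(1) P(2) by metis
  have "A = T" if "A \<in> \<I>" "T \<subseteq> A" for A
    using that card_seteq[OF finite_indep[OF that(1)] that(2)] card_indep_le_rank[OF that(1)] cT by simp
  then show ?thesis
    using P T unfolding feasible_partition_def matroid_bases_def is_transversal_iff_card by blast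
qed

text \<open>\<open>S\<close> is arbitrary because the class \<open>A\<close> charged for the last
  step is not known in advance; the induction hypothesis is then applied to
  \<open>S - {A}\<close>.\<close>

lemma greedy_splitting_cost:
  assumes sub: "submodular_on V f" and rank: "matroid_rank \<I> \<ge> 1"
    and Q: "feasible_partition V \<I> Q"
    and "greedy_splitting f V \<I> i P" "i \<le> matroid_rank \<I>" "S \<subseteq> Q" "Suc (card S) = i"
  shows "sum f P \<le> f V + (\<Sum>A\<in>S. f A + f (V - A) - f V)"
  using assms(4-7)
proof (induction arbitrary: S)
  case init
  have "finite Q" using Q finite_ground finite_elements unfolding feasible_partition_def by blast
  then have "finite S" using init finite_subset by blast
  then show ?case using init by simp
next
  case (step i P X W)
  obtain B where Q': "partition_on V Q" "card Q = matroid_rank \<I>" and B: "B \<in> \<I>" "is_transversal B Q"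
    using Q unfolding feasible_partition_def matroid_bases_def is_transversal_iff_card by blast
  have "finite Q" using Q'(1) finite_ground finite_elements by blast
  then have finS: "finite S" using step finite_subset by blast
  have inv: "partition_on V P" "card P = i" "\<exists>T\<in>\<I>. is_transversal T P"
    using greedy_splitting_invariant[OF step.hyps(1) rank] by auto
  obtain A W' where A: "A \<in> S" "admissible_split \<I> P (W' \<inter> A) W'"
    using exists_admissible_cut[OF inv(1,3) Q'(1) B, of S] step.prems inv(2) Q'(2) by auto
  have adm: "admissible_split \<I> P X W" using step.hyps(2) by (simp add: is_arg_min_def)
  have "W' \<subseteq> V" "A \<subseteq> V"
    using A inv(1) Q'(1) step.prems by (auto simp: admissible_split_def partition_on_def)
  \<comment> \<open>The cut of \<open>W'\<close> along \<open>A\<close> was a competing choice for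
    the greedy step.\<close>
  have "split_cost f X W \<le> split_cost f (W' \<inter> A) W'"
    using step.hyps(2) A(2) by (force simp: is_arg_min_linorder)
  also have "\<dots> \<le> f A + f (V - A) - f V"
    by (rule submodular_cut_cost[OF sub \<open>A \<subseteq> V\<close> \<open>W' \<subseteq> V\<close>])
  finally have "split_cost f X W \<le> f A + f (V - A) - f V" .
  moreover have "Suc (card (S - {A})) = i"
    using step.prems(3) A(1) card_Suc_Diff1[OF finS A(1)] by simp
  then have "sum f P \<le> f V + (\<Sum>A\<in>S - {A}. f A + f (V - A) - f V)"
    using step.prems by (intro step.IH) auto
  ultimately show ?case
    using admissible_split_partition(3)[OF inv(1) adm, of f] sum.remove[OF finS A(1), of "\<lambda>A. f A + f (V - A) - f V"]
    by simp
qed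

end

theorem theorem3:
  fixes V :: "'a set" and f :: "'a set \<Rightarrow> real" and \<I> :: "'a set set" and k :: nat
  assumes "finite V"
    and "\<And>A. A \<subseteq> V \<Longrightarrow> 0 \<le> f A"
    and "mono_on (Pow V) f"
    and "submodular_on V f"
    and "f {} = 0"
    and "matroid V \<I>"
    and "matroid_rank \<I> = k"
    and "k \<ge> 1"
  shows "(\<exists>P. greedy_splitting f V \<I> k P) \<and>
    (\<forall>P. greedy_splitting f V \<I> k P \<longrightarrow>
      feasible_partition V \<I> P \<and>
      (k \<ge> 2 \<longrightarrow> sum f P \<le> (2 - 2 / real k) * opt_value f V \<I>))"
proof -
  interpret matroid V \<I> by fact
  \<comment> \<open>For \<open>k = 1\<close> the factor is 0 while the run returns
    \<open>{V}\<close> at cost \<open>f V\<close>, hence the restriction to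
    \<open>k \<ge> 2\<close>.\<close>
  have bound: "sum f P \<le> (2 - 2 / real k) * opt_value f V \<I>"
    if P: "greedy_splitting f V \<I> k P" and k2: "k \<ge> 2" for P
  proof -
    let ?feas = "{P. feasible_partition V \<I> P}"
    let ?c = "\<lambda>A. f A + f (V - A) - f V"
    have "?feas \<subseteq> Pow (Pow V)"
      by (auto simp: feasible_partition_def partition_on_def)
    then have "finite ?feas" using assms(1) by (meson finite_Pow_iff finite_subset)
    moreover have "?feas \<noteq> {}" using greedy_splitting_feasible P assms(7,8) by blast
    ultimately have "opt_value f V \<I> \<in> sum f ` ?feas" unfolding opt_value_def by simp
    then obtain Q where Q: "feasible_partition V \<I> Q" and opt: "opt_value f V \<I> = sum f Q" by auto
    have part: "partition_on V Q" and cQ: "card Q = k"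
      using Q assms(7) by (auto simp: feasible_partition_def)
    have finQ: "finite Q" using part assms(1) finite_elements by blast
    have sub: "A \<subseteq> V" if "A \<in> Q" for A using that part by (auto simp: partition_on_def)
    obtain Z where Z: "Z \<in> Q" "\<And>A. A \<in> Q \<Longrightarrow> f A \<le> f Z"
      by (rule exists_max_on[OF finQ, of f]) (use cQ k2 in auto)
    have cS: "Suc (card (Q - {Z})) = k" using card_Suc_Diff1[OF finQ Z(1)] cQ by simp
    then have ne: "Q - {Z} \<noteq> {}" using k2 by (metis One_nat_def card.empty not_less_eq_eq numeral_2_eq_2 order_refl)
    obtain Y where Y: "Y \<in> Q - {Z}" "\<And>A. A \<in> Q - {Z} \<Longrightarrow> f A \<le> f Y"
      by (rule exists_max_on[of "Q - {Z}" f]) (use finQ ne in auto)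
    define R where "R = Q - {Z} - {Y}"
    have "Suc (card R) = card (Q - {Z})"
      unfolding R_def using finQ Y(1) by (intro card_Suc_Diff1) auto
    then have cR: "real (card R) = real k - 2" using cS by simp
    have sumQ: "sum f Q = f Z + f Y + sum f R"
      using sum.remove[OF finQ Z(1), of f] sum.remove[of "Q - {Z}" Y f] finQ Y(1) by (simp add: R_def)
    have "sum f P \<le> f V + sum ?c (Q - {Z})"
      by (rule greedy_splitting_cost[OF assms(4) _ Q P]) (use assms(7,8) cS in auto)
    \<comment> \<open>The summand \<open>?c Y\<close> contains \<open>- f V\<close>, which cancels
      the initial cost.\<close>
    also have "\<dots> = f Y + f (V - Y) + sum ?c R"
      using sum.remove[of "Q - {Z}" Y ?c] finQ Y(1) by (simp add: R_def)
    also have "sum ?c R \<le> sum f R"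
    proof (rule sum_mono)
      fix A assume "A \<in> R"
      have "f (V - A) \<le> f V" using assms(3) by (auto intro: mono_onD)
      then show "?c A \<le> f A" by simp
    qed
    also have "f (V - Y) \<le> f Z + sum f R"
    proof -
      have "V - Y = \<Union>(Q - {Y})"
        using part Y(1) by (auto simp: partition_on_def disjoint_def)
      moreover have "\<Union>(Q - {Y}) \<subseteq> V" using sub by blast
      ultimately have "f (V - Y) \<le> sum f (Q - {Y})"
        using submodular_Union_le[OF assms(4,5,2), of "Q - {Y}"] finQ by simp
      then show ?thesis using sum.remove[OF finQ, of Y f] Y(1) sumQ by simp
    qed
    finally have "sum f P \<le> sum f Q + sum f R" using sumQ by simp
    \<comment> \<open>Each of the \<open>k - 2\<close> classes in \<open>R\<close> costs at most
      \<open>f Y\<close> and at most \<open>f Z\<close>. Adding the two resulting bounds and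
      \<open>(k - 2) * sum f R\<close> on both sides gives the claim.\<close>
    moreover have "real k * sum f R \<le> (real k - 2) * sum f Q"
    proof -
      have "sum f R \<le> (real k - 2) * f Y" "sum f R \<le> (real k - 2) * f Z"
        using sum_bounded_above[of R f "f Y"] sum_bounded_above[of R f "f Z"] Y(2) Z(2) cR
        by (auto simp: R_def)
      then show ?thesis unfolding sumQ by (simp add: algebra_simps)
    qed
    then have "sum f R \<le> (1 - 2 / real k) * sum f Q"
      using k2 by (simp add: field_simps)
    ultimately show ?thesis unfolding opt by (simp add: algebra_simps)
  qed
  show ?thesis
    using greedy_splitting_exists[of k f] greedy_splitting_feasible bound assms(7,8) by blast
qed

end
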